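(* Let $(M,d)$ be a complete metric space with base point $0$. If $\mu\in\mathcal{M}(\beta\widetilde{M})$, then $\mathcal{S}(\Phi^*\mu)\subset\mathfrak{p}_s(\mathrm{supp}(\mu))$.
   Context: $(M,d)$ is a complete metric space with base point $0\in M$. $\mathrm{Lip}_0(M)$ is the Banach space of real-valued Lipschitz functions $f$ on $M$ with $f(0)=0$, normed by the optimal Lipschitz constant. $\widetilde{M}=\{(x,y)\in M\times M: x\neq y\}$ and $\beta\widetilde{M}$ is its Stone-Čech compactification. $\mathcal{M}(\beta\widetilde{M})$ is the space of signed (finite) Radon measures on $\beta\widetilde{M}$; $\mathrm{supp}(\mu)$ is the closed set of points all of whose open neighbourhoods have positive $|\mu|$-measure. $\Phi:\mathrm{Lip}_0(M)\to C(\beta\widetilde{M})$ is given by $(\Phi f)(x,y)=\frac{f(x)-f(y)}{d(x,y)}$ on $\widetilde{M}$, extended continuously to $\beta\widetilde{M}$; $\Phi^*:\mathcal{M}(\beta\widetilde{M})\to\mathrm{Lip}_0(M)^*$ is its adjoint. $M^{\mathcal{U}}$ is the uniform (Samuel) compactification of $M$: the unique compactification to which every bounded uniformly continuous $f:M\to\mathbb{R}$ extends continuously and in which the closures of $A,B\subset M$ are disjoint iff $d(A,B)>0$. $\mathfrak{p}_i:\beta\widetilde{M}\to M^{\mathcal{U}}$ ($i=1,2$) is the continuous extension of the $i$-th coordinate projection on $\widetilde{M}$. For $E\subset\beta\widetilde{M}$, its shadow is $\mathfrak{p}_s(E)=\mathfrak{p}_1(E)\cup\mathfrak{p}_2(E)$.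 For $\phi\in\mathrm{Lip}_0(M)^*$, the extended support is $$\mathcal{S}(\phi)=\bigcap\left\{\overline{A}^{\mathcal{U}}: A\subset M\text{ and }\langle f,\phi\rangle=0\text{ whenever }f\in\mathrm{Lip}_0(M)\text{ and }f|_A=0\right\},$$ where $\overline{A}^{\mathcal{U}}$ is the closure of $A$ in $M^{\mathcal{U}}$. *)

theory Defs
  imports "HOL-Analysis.Analysis"
begin

section \<open>Compactifications\<close>

text \<open>A compactification of a space is given by a topology together with the embedding of
  the space into it. The two compactifications below are each determined by their defining
  property only up to homeomorphism, so they are predicates.\<close>

definition compactification :: "'x topology \<Rightarrow> 'b topology \<Rightarrow> ('x \<Rightarrow> 'b) \<Rightarrow> bool" where
  "compactification X K i \<longleftrightarrow>
     compact_space K \<and> Hausdorff_space K \<and> embedding_map X K i \<and>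
     K closure_of (i ` topspace X) = topspace K"

definition stone_cech_compactification :: "'x topology \<Rightarrow> 'b topology \<Rightarrow> ('x \<Rightarrow> 'b) \<Rightarrow> bool" where
  "stone_cech_compactification X K i \<longleftrightarrow>
     compactification X K i \<and>
     (\<forall>f. continuous_map X euclideanreal f \<and> bounded (f ` topspace X) \<longrightarrow>
        (\<exists>g. continuous_map K euclideanreal g \<and> (\<forall>x\<in>topspace X. g (i x) = f x)))"

text \<open>\<open>d(A,B) > 0\<close> is spelled out rather than stated with \<open>setdist\<close>, because
  \<open>d(A,B) = \<infinity>\<close> for empty \<open>A\<close> or \<open>B\<close>, where \<open>setdist\<close> is 0.\<close>

definition uniform_compactification ::
  "'c topology \<Rightarrow> ('a::metric_space \<Rightarrow> 'c) \<Rightarrow> bool" where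
  "uniform_compactification K u \<longleftrightarrow>
     compactification euclidean K u \<and>
     (\<forall>f::'a \<Rightarrow> real. uniformly_continuous_on UNIV f \<and> bounded (range f) \<longrightarrow>
        (\<exists>g. continuous_map K euclideanreal g \<and> (\<forall>x. g (u x) = f x))) \<and>
     (\<forall>A B. K closure_of (u ` A) \<inter> K closure_of (u ` B) = {} \<longleftrightarrow>
        (\<exists>\<delta>>0. \<forall>a\<in>A. \<forall>b\<in>B. \<delta> \<le> dist a b))"

text \<open>The continuous extension along \<open>i\<close> of a map \<open>g\<close> given on \<open>D\<close>; for a compactification
  of \<open>D\<close> and a Hausdorff target it is unique on \<open>topspace K\<close> whenever it exists.\<close>

definition continuous_extension ::
  "'x set \<Rightarrow> 'b topology \<Rightarrow> ('x \<Rightarrow> 'b) \<Rightarrow> 'y topology \<Rightarrow> ('x \<Rightarrow> 'y) \<Rightarrow> 'b \<Rightarrow> 'y" where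
  "continuous_extension D K i Y g =
     (SOME h. continuous_map K Y h \<and> (\<forall>x\<in>D. h (i x) = g x))"


section \<open>Signed Radon measures on a compact Hausdorff space\<close>

definition Borel_sets :: "'b topology \<Rightarrow> 'b set set" where
  "Borel_sets X = sigma_sets (topspace X) {U. openin X U}"

text \<open>\<open>upper_variation X \<mu>\<close> is the positive part of the Jordan decomposition of \<open>\<mu>\<close>; the
  negative part is the upper variation of \<open>-\<mu>\<close>. Here \<open>ennreal\<close> sends negative values to 0,
  which does not affect the supremum since \<open>F = {}\<close> is admitted.\<close>

definition upper_variation :: "'b topology \<Rightarrow> ('b set \<Rightarrow> real) \<Rightarrow> 'b set \<Rightarrow> ennreal" where
  "upper_variation X \<mu> E = (SUP F\<in>{F \<in> Borel_sets X. F \<subseteq> E}. ennreal (\<mu> F))"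

definition total_variation :: "'b topology \<Rightarrow> ('b set \<Rightarrow> real) \<Rightarrow> 'b set \<Rightarrow> ennreal" where
  "total_variation X \<mu> E = upper_variation X \<mu> E + upper_variation X (\<lambda>F. - \<mu> F) E"

definition signed_Radon_measure :: "'b topology \<Rightarrow> ('b set \<Rightarrow> real) \<Rightarrow> bool" where
  "signed_Radon_measure X \<mu> \<longleftrightarrow>
     \<mu> {} = 0 \<and>
     (\<forall>E::nat \<Rightarrow> 'b set. range E \<subseteq> Borel_sets X \<and> disjoint_family E \<longrightarrow>
        (\<lambda>n. \<mu> (E n)) sums \<mu> (\<Union>n. E n)) \<and>
     total_variation X \<mu> (topspace X) < \<infinity> \<and>
     (\<forall>E\<in>Borel_sets X.
        total_variation X \<mu> E = (SUP C\<in>{C. compactin X C \<and> C \<subseteq> E}. total_variation X \<mu> C))"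

definition positive_part :: "'b topology \<Rightarrow> ('b set \<Rightarrow> real) \<Rightarrow> 'b measure" where
  "positive_part X \<mu> = measure_of (topspace X) {U. openin X U} (upper_variation X \<mu>)"

definition signed_integral :: "'b topology \<Rightarrow> ('b set \<Rightarrow> real) \<Rightarrow> ('b \<Rightarrow> real) \<Rightarrow> real" where
  "signed_integral X \<mu> f =
     integral\<^sup>L (positive_part X \<mu>) f - integral\<^sup>L (positive_part X (\<lambda>F. - \<mu> F)) f"

definition signed_support :: "'b topology \<Rightarrow> ('b set \<Rightarrow> real) \<Rightarrow> 'b set" where
  "signed_support X \<mu> =
     {x \<in> topspace X. \<forall>U. openin X U \<and> x \<in> U \<longrightarrow> total_variation X \<mu> U > 0}"


section \<open>Lipschitz functions and the de Leeuw map\<close>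

definition Lip0 :: "'a::metric_space \<Rightarrow> ('a \<Rightarrow> real) set" where
  "Lip0 z = {f. (\<exists>L. L-lipschitz_on UNIV f) \<and> f z = 0}"

definition off_diagonal :: "('a \<times> 'a) set" where
  "off_diagonal = {(x, y). x \<noteq> y}"

definition de_Leeuw :: "'b topology \<Rightarrow> ('a::metric_space \<times> 'a \<Rightarrow> 'b) \<Rightarrow> ('a \<Rightarrow> real) \<Rightarrow> 'b \<Rightarrow> real"
  where
  "de_Leeuw K i f =
     continuous_extension off_diagonal K i euclideanreal (\<lambda>(x, y). (f x - f y) / dist x y)"

text \<open>Functionals on \<open>Lip0 z\<close> are functions on all of \<open>'a \<Rightarrow> real\<close>, of which only the values
  on \<open>Lip0 z\<close> are relevant.\<close>

definition de_Leeuw_adjoint ::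
  "'b topology \<Rightarrow> ('a::metric_space \<times> 'a \<Rightarrow> 'b) \<Rightarrow> ('b set \<Rightarrow> real) \<Rightarrow> ('a \<Rightarrow> real) \<Rightarrow> real" where
  "de_Leeuw_adjoint K i \<mu> = (\<lambda>f. signed_integral K \<mu> (de_Leeuw K i f))"

definition extended_support ::
  "'a::metric_space \<Rightarrow> 'c topology \<Rightarrow> ('a \<Rightarrow> 'c) \<Rightarrow> (('a \<Rightarrow> real) \<Rightarrow> real) \<Rightarrow> 'c set" where
  "extended_support z K u \<phi> =
     \<Inter> {K closure_of (u ` A) | A. \<forall>f\<in>Lip0 z. (\<forall>x\<in>A. f x = 0) \<longrightarrow> \<phi> f = 0}"

definition shadow ::
  "'b topology \<Rightarrow> ('a \<times> 'a \<Rightarrow> 'b) \<Rightarrow> 'c topology \<Rightarrow> ('a \<Rightarrow> 'c) \<Rightarrow> 'b set \<Rightarrow> 'c set" where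
  "shadow K i K' u E =
     continuous_extension off_diagonal K i K' (\<lambda>(x, y). u x) ` E \<union>
     continuous_extension off_diagonal K i K' (\<lambda>(x, y). u y) ` E"

end

theory Submission
  imports Defs
begin

text \<open>Given a point off the shadow of \<open>supp \<mu>\<close>, separate it in the uniform compactification from
  the (compact) shadow by disjoint open sets and let \<open>A\<close> be the trace on \<open>M\<close> of the neighbourhood
  of the shadow. If \<open>f\<close> vanishes on \<open>A\<close>, then by density \<open>\<Phi> f\<close> vanishes on the
  set of points with both projections in that neighbourhood, hence on \<open>supp \<mu>\<close>, and \<open>\<mu>\<close>
  is concentrated on its support. So \<open>A\<close> takes part in the intersection defining the extended
  support, while its closure misses the given point.\<close>

section \<open>Extending maps from a space to its Stone-Cech compactification, with compact
  Hausdorff target\<close>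

text \<open>Urysohn for the disjoint closed sets \<open>{l}\<close> and the complement of
  \<open>W\<close>. It turns questions about \<open>Y\<close>-valued maps into questions about real
  functions, the only ones whose extension is given.\<close>

lemma compact_Hausdorff_separating_function:
  assumes "compact_space Y" "Hausdorff_space Y" "openin Y W" "l \<in> W"
  obtains h :: "'y \<Rightarrow> real" where
    "continuous_map Y euclideanreal h" "h l = 0" "\<And>y. y \<in> topspace Y - W \<Longrightarrow> h y = 1"
proof -
  have "normal_space Y"
    using assms(1,2) compact_Hausdorff_or_regular_imp_normal_space by blast
  moreover have "closedin Y {l}"
    using assms by (meson closedin_Hausdorff_singleton openin_subset subsetD)
  moreover have "closedin Y (topspace Y - W)"
    using assms(3) by blast
  moreover have "disjnt {l} (topspace Y - W)"
    using assms(4) by (auto simp: disjnt_def)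
  ultimately obtain h where h: "continuous_map Y (top_of_set {0..1::real}) h"
      "h ` {l} \<subseteq> {0}" "h ` (topspace Y - W) \<subseteq> {1}"
    by (metis Urysohn_lemma zero_le_one)
  show thesis
  proof (rule that)
    show "continuous_map Y euclideanreal h"
      using h(1) continuous_map_into_fulltopology by blast
  qed (use h in auto)
qed

text \<open>The value \<open>G \<xi>\<close> is a cluster point of \<open>g\<close> at \<open>\<xi>\<close>. Real functions \<open>h\<close> on \<open>Y\<close> separate
  points, and \<open>h (G \<xi>)\<close> must agree with the extension of \<open>h \<circ> g\<close>.\<close>

lemma stone_cech_extension:
  fixes g :: "'x \<Rightarrow> 'y"
  assumes K: "stone_cech_compactification X K i"
    and Y: "compact_space Y" "Hausdorff_space Y"
    and g: "continuous_map X Y g"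
  obtains G where "continuous_map K Y G" "\<And>x. x \<in> topspace X \<Longrightarrow> G (i x) = g x"
proof -
  define C where "C = {h::'y \<Rightarrow> real. continuous_map Y euclideanreal h}"
  have dense: "K closure_of (i ` topspace X) = topspace K"
    and emb: "embedding_map X K i"
    using K by (auto simp: stone_cech_compactification_def compactification_def)
  have iK: "i x \<in> topspace K" if "x \<in> topspace X" for x
    using emb that by (meson embedding_map_def homeomorphic_imp_continuous_map
        continuous_map_in_subtopology continuous_map_image_subset_topspace image_subset_iff)
  have "\<exists>G. continuous_map K euclideanreal G \<and> (\<forall>x\<in>topspace X. G (i x) = h (g x))"
    if "h \<in> C" for h
  proof -
    have h: "continuous_map Y euclideanreal h"
      using that by (simp add: C_def)
    have "bounded (h ` topspace Y)"
      using h Y(1) image_compactin[of Y "topspace Y" euclideanreal h]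
      by (simp add: compact_space_def compact_imp_bounded)
    moreover have "(h \<circ> g) ` topspace X \<subseteq> h ` topspace Y"
      using g by (auto simp: continuous_map_def)
    ultimately have "bounded ((h \<circ> g) ` topspace X)"
      using bounded_subset by blast
    moreover have "continuous_map X euclideanreal (h \<circ> g)"
      using g h continuous_map_compose by blast
    ultimately show ?thesis
      using K unfolding stone_cech_compactification_def by fastforce
  qed
  then obtain E where E: "\<And>h. h \<in> C \<Longrightarrow> continuous_map K euclideanreal (E h)"
      "\<And>h x. \<lbrakk>h \<in> C; x \<in> topspace X\<rbrakk> \<Longrightarrow> E h (i x) = h (g x)"
    by metis
  have "\<exists>l\<in>topspace Y. \<forall>h\<in>C. h l = E h \<xi>" if \<xi>: "\<xi> \<in> topspace K" for \<xi>
  proof -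
    \<comment> \<open>A point common to all \<open>N U\<close>, with \<open>U\<close> running over
      the neighbourhoods of \<open>\<xi>\<close>, is a cluster point of \<open>g\<close> at
      \<open>\<xi>\<close>; compactness of \<open>Y\<close> provides one through the finite
      intersection property.\<close>
    define N where "N U = Y closure_of (g ` {x \<in> topspace X. i x \<in> U})" for U
    define \<N> where "\<N> = {U. openin K U \<and> \<xi> \<in> U}"
    have "\<Inter>\<F> \<noteq> {}" if \<F>: "finite \<F>" "\<F> \<subseteq> N ` \<N>" for \<F>
    proof -
      obtain \<V> where \<V>: "finite \<V>" "\<V> \<subseteq> \<N>" "\<F> = N ` \<V>"
        using finite_subset_image[OF \<F>] by blast
      \<comment> \<open>Inserting \<open>topspace K\<close> keeps the intersection meaningful when
        \<open>\<V>\<close> is empty. Density then gives a point of \<open>X\<close> inside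
        \<open>V\<close>, whose image lies in every \<open>N U\<close> at once.\<close>
      define V where "V = \<Inter>(insert (topspace K) \<V>)"
      have "openin K V"
        unfolding V_def using \<V> by (intro openin_Inter) (auto simp: \<N>_def)
      moreover have "\<xi> \<in> V"
        using \<V> \<xi> by (auto simp: \<N>_def V_def)
      moreover have "\<xi> \<in> K closure_of (i ` topspace X)"
        using \<xi> dense by simp
      ultimately have "\<exists>y. y \<in> i ` topspace X \<and> y \<in> V"
        by (simp add: in_closure_of)
      then obtain x where x: "x \<in> topspace X" "i x \<in> V"
        by blast
      have "g x \<in> N U" if "U \<in> \<V>" for U
        unfolding N_def
        by (rule subsetD[OF closure_of_subset]) (use g x that in \<open>auto simp: continuous_map_def V_def\<close>)
      then show ?thesis
        using \<V>(3) by blast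
    qed
    moreover have "\<forall>D\<in>N ` \<N>. closedin Y D"
      by (simp add: N_def)
    ultimately have "\<Inter>(N ` \<N>) \<noteq> {}"
      using Y(1) unfolding compact_space_fip by presburger
    then obtain l where l: "\<And>U. U \<in> \<N> \<Longrightarrow> l \<in> N U"
      by blast
    have "topspace K \<in> \<N>"
      using \<xi> by (simp add: \<N>_def)
    then have lY: "l \<in> topspace Y"
      using l closure_of_subset_topspace unfolding N_def by fast
    have "h l = E h \<xi>" if h: "h \<in> C" for h
    proof -
      \<comment> \<open>On the neighbourhood \<open>U\<close> where \<open>E h\<close> is
        \<open>e\<close>-close to its value at \<open>\<xi>\<close>, \<open>h \<circ> g\<close> is
        \<open>e\<close>-close too; this closed condition passes to \<open>N U\<close> and hence to
        \<open>l\<close>.\<close>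
      have "\<bar>h l - E h \<xi>\<bar> \<le> e" if "e > 0" for e
      proof -
        define U where "U = {\<eta> \<in> topspace K. E h \<eta> \<in> ball (E h \<xi>) e}"
        have "openin K U"
          unfolding U_def using E(1)[OF h] by (rule openin_continuous_map_preimage) auto
        then have "U \<in> \<N>"
          using \<xi> that by (auto simp: \<N>_def U_def)
        define D where "D = {y \<in> topspace Y. h y \<in> cball (E h \<xi>) e}"
        have "closedin Y D"
          unfolding D_def
          by (rule closedin_continuous_map_preimage[of _ euclideanreal]) (use h in \<open>auto simp: C_def\<close>)
        moreover have "g ` {x \<in> topspace X. i x \<in> U} \<subseteq> D"
          using g E(2)[OF h] by (auto simp: U_def D_def continuous_map_def less_imp_le)
        ultimately have "N U \<subseteq> D"
          unfolding N_def by (intro closure_of_minimal)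
        then have "l \<in> D"
          using l[OF \<open>U \<in> \<N>\<close>] by blast
        then show ?thesis
          by (simp add: D_def dist_real_def abs_minus_commute)
      qed
      then show ?thesis
        using dense_ge[of 0 "\<bar>h l - E h \<xi>\<bar>"] by simp
    qed
    then show ?thesis
      using lY by blast
  qed
  then obtain G where G: "\<And>\<xi>. \<xi> \<in> topspace K \<Longrightarrow> G \<xi> \<in> topspace Y"
      "\<And>\<xi> h. \<lbrakk>\<xi> \<in> topspace K; h \<in> C\<rbrakk> \<Longrightarrow> h (G \<xi>) = E h \<xi>"
    by metis
  show thesis
  proof
    show "G (i x) = g x" if x: "x \<in> topspace X" for x
    proof (rule ccontr)
      assume ne: "G (i x) \<noteq> g x"
      have gx: "g x \<in> topspace Y"
        using g x by (auto simp: continuous_map_def)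
      \<comment> \<open>With the complement of \<open>g x\<close> as open set, the separating
        function is 0 at \<open>G (i x)\<close> and 1 at \<open>g x\<close>.\<close>
      have "openin Y (topspace Y - {g x})"
        using closedin_Hausdorff_singleton[OF Y(2) gx] by (simp add: openin_diff)
      moreover have "G (i x) \<in> topspace Y - {g x}"
        using ne G(1)[OF iK[OF x]] by simp
      ultimately obtain h where h: "continuous_map Y euclideanreal h" "h (G (i x)) = 0"
          "\<And>y. y \<in> topspace Y - (topspace Y - {g x}) \<Longrightarrow> h y = 1"
        using compact_Hausdorff_separating_function[OF Y] by (metis (no_types, lifting))
      have "h \<in> C"
        using h(1) by (simp add: C_def)
      then have "h (G (i x)) = h (g x)"
        using E(2) G(2) iK x by simp
      then show False
        using h gx by simp
    qed
    show "continuous_map K Y G"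
      unfolding continuous_map_def
    proof (intro conjI allI impI)
      show "G \<in> topspace K \<rightarrow> topspace Y"
        using G(1) by blast
      fix W assume W: "openin Y W"
      show "openin K {\<xi> \<in> topspace K. G \<xi> \<in> W}"
      proof (subst openin_subopen, clarify)
        fix \<xi> assume \<xi>: "\<xi> \<in> topspace K" "G \<xi> \<in> W"
        obtain h where h: "continuous_map Y euclideanreal h" "h (G \<xi>) = 0"
            "\<And>y. y \<in> topspace Y - W \<Longrightarrow> h y = 1"
          using compact_Hausdorff_separating_function[OF Y W \<xi>(2)] by (metis (no_types, lifting))
        have hC: "h \<in> C"
          using h(1) by (simp add: C_def)
        \<comment> \<open>\<open>E h\<close> agrees with \<open>h \<circ> G\<close> on
          \<open>K\<close> and is already known to be continuous, so \<open>T\<close> is open; since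
          \<open>h\<close> is 1 off \<open>W\<close>, values below 1 force \<open>G \<eta>\<close>
          into \<open>W\<close>.\<close>
        define T where "T = {\<eta> \<in> topspace K. E h \<eta> \<in> {..<1}}"
        have "openin K T"
          unfolding T_def using E(1)[OF hC] by (rule openin_continuous_map_preimage) auto
        moreover have "\<xi> \<in> T"
          using \<xi>(1) G(2)[OF \<xi>(1) hC] h(2) by (simp add: T_def)
        moreover have "T \<subseteq> {\<xi> \<in> topspace K. G \<xi> \<in> W}"
        proof clarify
          fix \<eta> assume "\<eta> \<in> T"
          then have "\<eta> \<in> topspace K" "h (G \<eta>) < 1"
            using G(2)[OF _ hC] by (auto simp: T_def)
          then show "\<eta> \<in> topspace K \<and> G \<eta> \<in> W"
            using h(3) G(1) by (metis DiffI less_irrefl)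
        qed
        ultimately show "\<exists>T. openin K T \<and> \<xi> \<in> T \<and> T \<subseteq> {\<xi> \<in> topspace K. G \<xi> \<in> W}"
          by blast
      qed
    qed
  qed
qed

text \<open>The extension is a \<open>SOME\<close> choice, so its properties rest on exhibiting one
  candidate \<open>h\<close>.\<close>

lemma continuous_extension_works:
  assumes "continuous_map K Y h" "\<And>x. x \<in> D \<Longrightarrow> h (i x) = g x"
  shows "continuous_map K Y (continuous_extension D K i Y g)"
    and "x \<in> D \<Longrightarrow> continuous_extension D K i Y g (i x) = g x"
proof -
  let ?h = "continuous_extension D K i Y g"
  have "\<exists>h. continuous_map K Y h \<and> (\<forall>x\<in>D. h (i x) = g x)"
    using assms by blast
  then have "continuous_map K Y ?h \<and> (\<forall>x\<in>D. ?h (i x) = g x)"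
    unfolding continuous_extension_def by (rule someI_ex)
  then show "continuous_map K Y ?h" "x \<in> D \<Longrightarrow> ?h (i x) = g x"
    by auto
qed

section \<open>Null sets of the total variation, and integrals of functions vanishing on the
  support\<close>

text \<open>Zero upper variation means that \<open>c * \<mu>\<close> is nonpositive on Borel
  subsets, and a Borel subset of the union splits along \<open>A\<close> into two such pieces. The
  factor \<open>c\<close> covers \<open>\<mu>\<close> and its negative together.\<close>

lemma upper_variation_Un_null:
  assumes \<mu>: "signed_Radon_measure X \<mu>"
    and A: "A \<in> Borel_sets X"
    and null: "upper_variation X (\<lambda>F. c * \<mu> F) A = 0" "upper_variation X (\<lambda>F. c * \<mu> F) B = 0"
  shows "upper_variation X (\<lambda>F. c * \<mu> F) (A \<union> B) = 0"
proof -
  have neg: "c * \<mu> F \<le> 0" if "F \<in> Borel_sets X" "F \<subseteq> A \<or> F \<subseteq> B" for F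
  proof -
    have "ennreal (c * \<mu> F) \<le> 0"
      using null that unfolding upper_variation_def
      by (metis (mono_tags, lifting) SUP_upper mem_Collect_eq)
    then show ?thesis
      by (simp add: ennreal_eq_0_iff)
  qed
  interpret sigma_algebra "topspace X" "Borel_sets X"
    unfolding Borel_sets_def by (rule sigma_algebra_sigma_sets) (auto dest: openin_subset)
  have "ennreal (c * \<mu> F) = 0" if F: "F \<in> Borel_sets X" "F \<subseteq> A \<union> B" for F
  proof -
    \<comment> \<open>Padding with empty sets extracts finite additivity from countable additivity,
      as \<open>\<mu> {} = 0\<close>.\<close>
    define E where "E n = (if n = 0 then F \<inter> A else if n = 1 then F - A else {})" for n :: nat
    have "range E \<subseteq> Borel_sets X" "disjoint_family E" "(\<Union>n. E n) = F"
      using F A by (auto simp: E_def disjoint_family_on_def split: if_splits)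
    then have "(\<lambda>n. \<mu> (E n)) sums \<mu> F" and "\<mu> {} = 0"
      using \<mu> unfolding signed_Radon_measure_def by metis+
    moreover have "(\<lambda>n. \<mu> (E n)) sums (\<Sum>n<2. \<mu> (E n))"
      by (rule sums_finite) (use \<open>\<mu> {} = 0\<close> in \<open>auto simp: E_def\<close>)
    ultimately have "\<mu> F = \<mu> (F \<inter> A) + \<mu> (F - A)"
      using sums_unique2 by (fastforce simp: E_def numeral_2_eq_2)
    moreover have "c * \<mu> (F \<inter> A) \<le> 0" "c * \<mu> (F - A) \<le> 0"
      using neg F A by blast+
    ultimately show ?thesis
      by (simp add: ennreal_eq_0_iff distrib_left)
  qed
  then show ?thesis
    unfolding upper_variation_def by (auto intro!: antisym SUP_least)
qed

lemma total_variation_Un_null: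
  assumes "signed_Radon_measure X \<mu>" "A \<in> Borel_sets X"
    and "total_variation X \<mu> A = 0" "total_variation X \<mu> B = 0"
  shows "total_variation X \<mu> (A \<union> B) = 0"
  using upper_variation_Un_null[OF assms(1,2), where c=1 and B=B]
    upper_variation_Un_null[OF assms(1,2), where c="-1" and B=B] assms(3,4)
  by (simp add: total_variation_def)

lemma total_variation_mono:
  assumes "A \<subseteq> B"
  shows "total_variation X \<mu> A \<le> total_variation X \<mu> B"
  unfolding total_variation_def upper_variation_def
  by (intro add_mono SUP_subset_mono) (use assms in auto)

lemma total_variation_Union_null:
  assumes \<mu>: "signed_Radon_measure X \<mu>" and "finite \<U>"
    and "\<And>U. U \<in> \<U> \<Longrightarrow> openin X U \<and> total_variation X \<mu> U = 0"
  shows "total_variation X \<mu> (\<Union>\<U>) = 0"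
  using assms(2,3)
proof (induction \<U>)
  case empty
  have "ennreal (\<mu> F) = 0" "ennreal (- \<mu> F) = 0" if "F \<subseteq> {}" for F
    using \<mu> that by (auto simp: signed_Radon_measure_def)
  then show ?case
    unfolding total_variation_def upper_variation_def
    by (auto intro!: antisym SUP_least)
next
  case (insert U \<U>)
  then have "U \<in> Borel_sets X"
    by (simp add: Borel_sets_def)
  then show ?case
    using total_variation_Un_null[OF \<mu>, of U "\<Union>\<U>"] insert by simp
qed

lemma openin_off_signed_support: "openin X (topspace X - signed_support X \<mu>)"
proof (subst openin_subopen, clarify)
  fix x assume x: "x \<in> topspace X" "x \<notin> signed_support X \<mu>"
  then obtain U where U: "openin X U" "x \<in> U" "\<not> total_variation X \<mu> U > 0"
    by (auto simp: signed_support_def)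
  then have "U \<subseteq> topspace X - signed_support X \<mu>"
    using openin_subset by (fastforce simp: signed_support_def)
  then show "\<exists>T. openin X T \<and> x \<in> T \<and> T \<subseteq> topspace X - signed_support X \<mu>"
    using U by blast
qed

text \<open>An arbitrary union of null open sets is null only by inner regularity: each of its compact
  subsets is covered by finitely many of them.\<close>

lemma total_variation_off_signed_support:
  assumes \<mu>: "signed_Radon_measure X \<mu>"
  shows "total_variation X \<mu> (topspace X - signed_support X \<mu>) = 0"
proof -
  let ?N = "topspace X - signed_support X \<mu>"
  have "total_variation X \<mu> C = 0" if C: "compactin X C" "C \<subseteq> ?N" for C
  proof -
    let ?\<U> = "{U. openin X U \<and> total_variation X \<mu> U = 0}"
    have "C \<subseteq> \<Union>?\<U>"
      using C by (auto simp: signed_support_def zero_less_iff_neq_zero)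
    then obtain \<F> where \<F>: "finite \<F>" "\<F> \<subseteq> ?\<U>" "C \<subseteq> \<Union>\<F>"
      using C(1) unfolding compactin_def by (metis (no_types, lifting) mem_Collect_eq)
    then have "total_variation X \<mu> (\<Union>\<F>) = 0"
      by (intro total_variation_Union_null[OF \<mu>]) auto
    then show ?thesis
      using total_variation_mono[OF \<F>(3), of X \<mu>] by simp
  qed
  moreover have "?N \<in> Borel_sets X"
    using openin_off_signed_support by (auto simp: Borel_sets_def)
  then have "total_variation X \<mu> ?N = (SUP C\<in>{C. compactin X C \<and> C \<subseteq> ?N}. total_variation X \<mu> C)"
    using \<mu> unfolding signed_Radon_measure_def by blast
  ultimately show ?thesis
    by (auto intro!: antisym SUP_least)
qed

text \<open>\<^const>\<open>measure_of\<close> yields the zero measure should its argument fail to be a measure, so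
  there is no need to know that the upper variation is countably additive.\<close>

lemma integral_positive_part_eq_0:
  assumes null: "upper_variation X \<mu> (topspace X - S) = 0"
    and N: "openin X (topspace X - S)"
    and f: "\<And>x. x \<in> topspace X \<inter> S \<Longrightarrow> f x = 0"
  shows "integral\<^sup>L (positive_part X \<mu>) f = 0"
proof (rule integral_eq_zero_AE, rule AE_I)
  let ?N = "topspace X - S"
  have sub: "{U. openin X U} \<subseteq> Pow (topspace X)"
    by (auto dest: openin_subset)
  show "{x \<in> space (positive_part X \<mu>). f x \<noteq> 0} \<subseteq> ?N"
    using f sub by (auto simp: positive_part_def space_measure_of)
  show "?N \<in> sets (positive_part X \<mu>)"
    using N sub by (auto simp: positive_part_def sets_measure_of)
  show "emeasure (positive_part X \<mu>) ?N = 0"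
    using null sub by (simp add: positive_part_def emeasure_measure_of_conv)
qed

lemma signed_integral_eq_0:
  assumes \<mu>: "signed_Radon_measure X \<mu>"
    and f: "\<And>x. x \<in> signed_support X \<mu> \<Longrightarrow> f x = 0"
  shows "signed_integral X \<mu> f = 0"
proof -
  have "upper_variation X \<mu> (topspace X - signed_support X \<mu>) = 0"
    "upper_variation X (\<lambda>F. - \<mu> F) (topspace X - signed_support X \<mu>) = 0"
    using total_variation_off_signed_support[OF \<mu>] by (auto simp: total_variation_def)
  then have "integral\<^sup>L (positive_part X \<mu>) f = 0"
    "integral\<^sup>L (positive_part X (\<lambda>F. - \<mu> F)) f = 0"
    using f openin_off_signed_support[of X \<mu>]
    by (auto intro!: integral_positive_part_eq_0[where S="signed_support X \<mu>"])
  then show ?thesis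
    by (simp add: signed_integral_def)
qed

section \<open>The de Leeuw map and vanishing by density\<close>

text \<open>A Lipschitz constant bounds the difference quotient, which is continuous off the
  diagonal, so the extension property for bounded functions applies.\<close>

lemma de_Leeuw_works:
  assumes K: "stone_cech_compactification (top_of_set off_diagonal) K i" and f: "f \<in> Lip0 z"
  shows "continuous_map K euclideanreal (de_Leeuw K i f)"
    and "x \<noteq> y \<Longrightarrow> de_Leeuw K i f (i (x, y)) = (f x - f y) / dist x y"
proof -
  let ?q = "\<lambda>(x, y). (f x - f y) / dist x y"
  obtain L where L: "L-lipschitz_on UNIV f"
    using f by (auto simp: Lip0_def)
  have "continuous_on UNIV f"
    using L lipschitz_on_continuous_on by blast
  then have "continuous_on off_diagonal ?q"
    unfolding case_prod_unfold
    by (auto simp: off_diagonal_def intro!: continuous_intros continuous_on_compose2[of UNIV f])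
  moreover have "\<bar>?q p\<bar> \<le> L" if "p \<in> off_diagonal" for p
    using that lipschitz_onD[OF L]
    by (cases p) (auto simp: off_diagonal_def dist_real_def field_simps)
  then have "bounded (?q ` off_diagonal)"
    unfolding bounded_iff by (intro exI[of _ L]) fastforce
  ultimately have "\<exists>h. continuous_map K euclideanreal h \<and> (\<forall>p\<in>off_diagonal. h (i p) = ?q p)"
    using K by (simp add: stone_cech_compactification_def)
  then obtain h where "continuous_map K euclideanreal h"
      "\<And>p. p \<in> off_diagonal \<Longrightarrow> h (i p) = ?q p"
    by blast
  note * = continuous_extension_works[of K euclideanreal h off_diagonal i ?q, OF this]
  show "continuous_map K euclideanreal (de_Leeuw K i f)"
    unfolding de_Leeuw_def by (rule *(1))
  show "x \<noteq> y \<Longrightarrow> de_Leeuw K i f (i (x, y)) = (f x - f y) / dist x y"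
    unfolding de_Leeuw_def using *(2)[of "(x, y)"] by (simp add: off_diagonal_def)
qed

text \<open>Otherwise the part of \<open>N\<close> where \<open>h\<close> is nonzero would be an
  open neighbourhood of \<open>\<xi>\<close> and would meet \<open>D\<close>.\<close>

lemma continuous_map_eq_0_if_dense:
  fixes h :: "'b \<Rightarrow> real"
  assumes h: "continuous_map K euclideanreal h" and dense: "K closure_of D = topspace K"
    and N: "openin K N" "\<xi> \<in> N" and 0: "\<And>\<eta>. \<eta> \<in> N \<inter> D \<Longrightarrow> h \<eta> = 0"
  shows "h \<xi> = 0"
proof (rule ccontr)
  assume "h \<xi> \<noteq> 0"
  let ?U = "N \<inter> {\<eta> \<in> topspace K. h \<eta> \<in> - {0}}"
  have "openin K {\<eta> \<in> topspace K. h \<eta> \<in> - {0}}"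
    using h by (rule openin_continuous_map_preimage) auto
  then have "openin K ?U"
    using N(1) by blast
  moreover have "\<xi> \<in> topspace K"
    using N openin_subset by blast
  then have "\<xi> \<in> ?U" "\<xi> \<in> K closure_of D"
    using N(2) \<open>h \<xi> \<noteq> 0\<close> dense by auto
  ultimately obtain \<eta> where "\<eta> \<in> D" "\<eta> \<in> ?U"
    unfolding in_closure_of by meson
  then show False
    using 0 by blast
qed

section \<open>The extended support lies in the shadow\<close>

theorem proposition5p3:
  fixes z :: "'a::complete_space"
    and \<beta>M :: "'b topology" and i :: "'a \<times> 'a \<Rightarrow> 'b"
    and MU :: "'c topology" and u :: "'a \<Rightarrow> 'c"
    and \<mu> :: "'b set \<Rightarrow> real"
  assumes "stone_cech_compactification (top_of_set off_diagonal) \<beta>M i"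
    and "uniform_compactification MU u"
    and "signed_Radon_measure \<beta>M \<mu>"
  shows "extended_support z MU u (de_Leeuw_adjoint \<beta>M i \<mu>)
           \<subseteq> shadow \<beta>M i MU u (signed_support \<beta>M \<mu>)"
proof
  fix \<zeta> assume \<zeta>: "\<zeta> \<in> extended_support z MU u (de_Leeuw_adjoint \<beta>M i \<mu>)"
  note SC = assms(1)
  let ?supp = "signed_support \<beta>M \<mu>"
  let ?S = "shadow \<beta>M i MU u ?supp"
  have dense: "\<beta>M closure_of (i ` off_diagonal) = topspace \<beta>M" and "compact_space \<beta>M"
    using SC by (auto simp: stone_cech_compactification_def compactification_def)
  have MU: "compact_space MU" "Hausdorff_space MU" and "embedding_map euclidean MU u"
    using assms(2) by (auto simp: uniform_compactification_def compactification_def)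
  then have u: "continuous_map euclidean MU u"
    by (meson embedding_map_def homeomorphic_imp_continuous_map continuous_map_into_fulltopology)
  \<comment> \<open>Taking \<open>k\<close> to be \<open>fst\<close> or \<open>snd\<close> gives the
    two extended projections that form the shadow.\<close>
  define p where "p k = continuous_extension off_diagonal \<beta>M i MU (\<lambda>q. u (k q))"
    for k :: "'a \<times> 'a \<Rightarrow> 'a"
  have p: "continuous_map \<beta>M MU (p k)" "\<And>q. q \<in> off_diagonal \<Longrightarrow> p k (i q) = u (k q)"
    if k: "continuous_on UNIV k" for k
  proof -
    have "continuous_map (top_of_set off_diagonal) euclidean k"
      using continuous_on_subset[OF k] by simp
    then have "continuous_map (top_of_set off_diagonal) MU (\<lambda>q. u (k q))"
      using u continuous_map_compose[of _ euclidean k MU u] by (simp add: o_def)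
    then obtain h where h: "continuous_map \<beta>M MU h"
        "\<And>q. q \<in> off_diagonal \<Longrightarrow> h (i q) = u (k q)"
      using stone_cech_extension[OF SC MU] by (metis topspace_euclidean_subtopology)
    show "continuous_map \<beta>M MU (p k)" "\<And>q. q \<in> off_diagonal \<Longrightarrow> p k (i q) = u (k q)"
      unfolding p_def using continuous_extension_works[of \<beta>M MU h off_diagonal i, OF h] by auto
  qed
  have S: "?S = p fst ` ?supp \<union> p snd ` ?supp"
    by (simp add: shadow_def p_def case_prod_unfold)
  have fs: "continuous_on UNIV (fst :: 'a \<times> 'a \<Rightarrow> 'a)" "continuous_on UNIV (snd :: 'a \<times> 'a \<Rightarrow> 'a)"
    by (auto intro: continuous_intros)
  have supp: "?supp \<subseteq> topspace \<beta>M"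
    by (auto simp: signed_support_def)
  then have "closedin \<beta>M ?supp"
    using openin_off_signed_support by (simp add: closedin_def)
  then have "compactin \<beta>M ?supp"
    using \<open>compact_space \<beta>M\<close> closedin_compact_space by blast
  then have comp: "compactin MU ?S"
    unfolding S by (intro compactin_Un image_compactin[OF _ p(1)] fs)
  \<comment> \<open>The trace \<open>?A\<close> of any open \<open>W\<close> around the shadow is
    admissible in the intersection that defines the extended support.\<close>
  have avoid: "\<zeta> \<in> MU closure_of W" if W: "openin MU W" "?S \<subseteq> W" for W
  proof -
    let ?A = "u -` W"
    have "de_Leeuw_adjoint \<beta>M i \<mu> f = 0" if f: "f \<in> Lip0 z" "\<forall>x\<in>?A. f x = 0" for f
      unfolding de_Leeuw_adjoint_def
    proof (rule signed_integral_eq_0[OF assms(3)])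
      fix \<xi> assume \<xi>: "\<xi> \<in> ?supp"
      let ?N = "{\<eta> \<in> topspace \<beta>M. p fst \<eta> \<in> W} \<inter> {\<eta> \<in> topspace \<beta>M. p snd \<eta> \<in> W}"
      show "de_Leeuw \<beta>M i f \<xi> = 0"
      proof (rule continuous_map_eq_0_if_dense[OF de_Leeuw_works(1)[OF SC f(1)] dense])
        show "openin \<beta>M ?N"
          by (intro openin_Int openin_continuous_map_preimage[OF p(1)] fs W)
        show "\<xi> \<in> ?N"
          using \<xi> supp W(2) unfolding S by blast
        fix \<eta> assume "\<eta> \<in> ?N \<inter> i ` off_diagonal"
        then obtain x y where xy: "x \<noteq> y" "\<eta> = i (x, y)" "p fst \<eta> \<in> W" "p snd \<eta> \<in> W"
          by (auto simp: off_diagonal_def)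
        \<comment> \<open>On \<open>i (x, y)\<close> the extended projections are \<open>u x\<close>
          and \<open>u y\<close>, so \<open>f\<close> vanishes at both points and its difference
          quotient is 0.\<close>
        then have "x \<in> ?A" "y \<in> ?A"
          using p(2)[OF fs(1), of "(x, y)"] p(2)[OF fs(2), of "(x, y)"]
          by (auto simp: off_diagonal_def)
        then show "de_Leeuw \<beta>M i f \<eta> = 0"
          using f(2) xy(1,2) de_Leeuw_works(2)[OF SC f(1)] by simp
      qed
    qed
    then have "\<zeta> \<in> MU closure_of (u ` ?A)"
      using \<zeta> unfolding extended_support_def by blast
    then show ?thesis
      by (meson closure_of_mono image_vimage_subset subsetD)
  qed
  show "\<zeta> \<in> ?S"
  proof (rule ccontr)
    assume "\<zeta> \<notin> ?S"
    \<comment> \<open>The whole space is itself an open set around the shadow.\<close>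
    have "\<zeta> \<in> topspace MU"
      using avoid[of "topspace MU"] comp compactin_subset_topspace by force
    then have "compactin MU {\<zeta>}" "disjnt {\<zeta>} ?S"
      using \<open>\<zeta> \<notin> ?S\<close> by auto
    then obtain V W where VW: "openin MU V" "openin MU W" "\<zeta> \<in> V" "?S \<subseteq> W" "disjnt V W"
      using MU(2) comp unfolding Hausdorff_space_compact_sets by (metis insert_subset)
    \<comment> \<open>\<open>V\<close> is a neighbourhood of \<open>\<zeta>\<close> missing
      \<open>W\<close>, although \<open>\<zeta>\<close> lies in the closure of
      \<open>W\<close>.\<close>
    then show False
      using avoid[OF VW(2,4)] by (auto simp: in_closure_of disjnt_iff)
  qed
qed

end
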